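(* Let $x$ be a nonconstant rational $\overline{\mathbb{E}}$-inner function. Then either $x(\overline{\mathbb{D}})\subseteq \mathcal{R}_{\overline{\mathbb{E}}}\cap\overline{\mathbb{E}}$, or $x(\overline{\mathbb{D}})$ meets $\mathcal{R}_{\overline{\mathbb{E}}}$ exactly $\deg(x)$ times, that is, the sum of the multiplicities $\#\sigma$ of the royal nodes $\sigma\in\overline{\mathbb{D}}$ of $x$ is equal to $\deg(x)$.
   Context: $\mathbb{D}$ is the open unit disc and $\mathbb{T}$ the unit circle in $\mathbb{C}$. The open tetrablock is $\mathbb{E}=\{(x_1,x_2,x_3)\in\mathbb{C}^3: 1-x_1z-x_2w+x_3zw\neq 0 \text{ whenever } |z|\le 1,|w|\le 1\}$, with closure $\overline{\mathbb{E}}$. Its distinguished boundary is $b\overline{\mathbb{E}}=\{x\in\mathbb{C}^3: x_1=\overline{x_2}x_3,\ |x_3|=1,\ |x_2|\le 1\}$. A rational $\overline{\mathbb{E}}$-inner function is a rational analytic map $x=(x_1,x_2,x_3):\mathbb{D}\to\overline{\mathbb{E}}$ (automatically continuous on $\overline{\mathbb{D}}$) that maps $\mathbb{T}$ into $b\overline{\mathbb{E}}$. Degree: $\pi_1(b\overline{\mathbb{E}})\cong\mathbb{Z}$, and $\deg(x)$ is $x_*(1)$, where $x_*:\mathbb{Z}=\pi_1(\mathbb{T})\to\pi_1(b\overline{\mathbb{E}})=\mathbb{Z}$ is the homomorphism induced by $x|_{\mathbb{T}}:\mathbb{T}\to b\overline{\mathbb{E}}$; the identification with $\mathbb{Z}$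 is such that $\deg(x)$ is a non-negative integer. The royal variety is $\mathcal{R}_{\overline{\mathbb{E}}}=\{(x_1,x_2,x_3)\in\mathbb{C}^3:x_1x_2=x_3\}$. For a polynomial $f$ of degree at most $n$, $f^{\sim n}(\lambda)=\lambda^n\overline{f(1/\overline{\lambda})}$. A rational $\overline{\mathbb{E}}$-inner function $x$ of degree $n$ can be written $x=(E_1/D,\,E_2/D,\,D^{\sim n}/D)$ with polynomials $E_1,E_2,D$ of degree at most $n$, $D\ne0$ on $\overline{\mathbb{D}}$; these are unique up to a common nonzero real factor. The royal polynomial of $x$ is $R_x=D^{\sim n}D-E_1E_2$. Points $\sigma\in\overline{\mathbb{D}}$ with $x(\sigma)\in\mathcal{R}_{\overline{\mathbb{E}}}$ (equivalently, zeros of $R_x$ in $\overline{\mathbb{D}}$) are called royal nodes of $x$. If $x(\overline{\mathbb{D}})\not\subseteq\mathcal{R}_{\overline{\mathbb{E}}}$ and $\sigma\in\overline{\mathbb D}$ is a zero of $R_x$ of order $\ell$, the multiplicity of the royal node $\sigma$ is $\#\sigma=\ell$ if $\sigma\in\mathbb{D}$ and $\#\sigma=\ell/2$ if $\sigma\in\mathbb{T}$. The number of times that $x(\overline{\mathbb D})$ meets $\mathcal{R}_{\overline{\mathbb E}}$ is counted with these multiplicities. *)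

theory Defs
  imports
    "HOL-Analysis.Analysis"
    "HOL-Computational_Algebra.Polynomial"
    "HOL-Algebra.Elementary_Groups"
begin

definition tetrablock :: "(complex \<times> complex \<times> complex) set" where
  "tetrablock =
     {(x1, x2, x3). \<forall>z w. norm z \<le> 1 \<longrightarrow> norm w \<le> 1 \<longrightarrow> 1 - x1 * z - x2 * w + x3 * z * w \<noteq> 0}"

definition tetrablock_bd :: "(complex \<times> complex \<times> complex) set" where
  "tetrablock_bd = {(x1, x2, x3). x1 = cnj x2 * x3 \<and> norm x3 = 1 \<and> norm x2 \<le> 1}"

definition royal_variety :: "(complex \<times> complex \<times> complex) set" where
  "royal_variety = {(x1, x2, x3). x1 * x2 = x3}"

definition rational_on :: "complex set \<Rightarrow> (complex \<Rightarrow> complex) \<Rightarrow> bool" where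
  "rational_on S f \<longleftrightarrow>
     (\<exists>p q :: complex poly. \<forall>z\<in>S. poly q z \<noteq> 0 \<and> f z = poly p z / poly q z)"

text \<open>A rational map that is bounded on the disc extends continuously to the closed disc. The
  continuity requirement below says that the values of \<open>x\<close> on the unit circle are those of this
  extension; values outside the closed disc are irrelevant.\<close>

definition rational_tetra_inner :: "(complex \<Rightarrow> complex \<times> complex \<times> complex) \<Rightarrow> bool" where
  "rational_tetra_inner x \<longleftrightarrow>
     rational_on (ball 0 1) (\<lambda>z. fst (x z)) \<and>
     rational_on (ball 0 1) (\<lambda>z. fst (snd (x z))) \<and>
     rational_on (ball 0 1) (\<lambda>z. snd (snd (x z))) \<and>
     continuous_on (cball 0 1) x \<and>
     x ` ball 0 1 \<subseteq> closure tetrablock \<and>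
     x ` sphere 0 1 \<subseteq> tetrablock_bd"

definition loops_at :: "'a::topological_space set \<Rightarrow> 'a \<Rightarrow> (real \<Rightarrow> 'a) set" where
  "loops_at S b = {p. path p \<and> path_image p \<subseteq> S \<and> pathstart p = b \<and> pathfinish p = b}"

definition path_class :: "'a::topological_space set \<Rightarrow> (real \<Rightarrow> 'a) \<Rightarrow> (real \<Rightarrow> 'a) set" where
  "path_class S p = {q. homotopic_paths S p q}"

text \<open>In the next two definitions all sets in the unions coincide, by compatibility of path
  concatenation and of composition with homotopy.\<close>

definition fundamental_group ::
    "'a::topological_space set \<Rightarrow> 'a \<Rightarrow> (real \<Rightarrow> 'a) set monoid" where
  "fundamental_group S b =
     \<lparr>carrier = path_class S ` loops_at S b,
      mult = (\<lambda>A B. \<Union>p\<in>A. \<Union>q\<in>B. path_class S (p +++ q)),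
      one = path_class S (\<lambda>_. b)\<rparr>"

definition induced_map ::
    "'b::topological_space set \<Rightarrow> ('a::topological_space \<Rightarrow> 'b) \<Rightarrow> (real \<Rightarrow> 'a) set \<Rightarrow> (real \<Rightarrow> 'b) set"
  where "induced_map T f A = (\<Union>p\<in>A. path_class T (f \<circ> p))"

definition circle_loop :: "real \<Rightarrow> complex" where
  "circle_loop t = cis (2 * pi * t)"

text \<open>The identification of the fundamental group of the distinguished boundary with the integers.
  There are two isomorphisms; the one chosen sends to 1 the loops (based at \<open>b\<close>) that are freely
  homotopic to the boundary loop of the inner function mapping \<open>z\<close> to \<open>(0, 0, z)\<close>. This is the
  orientation which makes the degrees of inner functions non-negative.\<close>

definition tetra_pi1_identification ::
    "complex \<times> complex \<times> complex \<Rightarrow> ((real \<Rightarrow> complex \<times> complex \<times> complex) set \<Rightarrow> int) \<Rightarrow> bool"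
  where "tetra_pi1_identification b \<phi> \<longleftrightarrow>
     \<phi> \<in> iso (fundamental_group tetrablock_bd b) integer_group \<and>
     (\<forall>p\<in>loops_at tetrablock_bd b.
        homotopic_loops tetrablock_bd p (\<lambda>t. (0, 0, circle_loop t)) \<longrightarrow>
        \<phi> (path_class tetrablock_bd p) = 1)"

text \<open>The class of \<^const>\<open>circle_loop\<close> is the generator 1 of the fundamental group of the circle.\<close>

definition tetra_degree :: "(complex \<Rightarrow> complex \<times> complex \<times> complex) \<Rightarrow> nat" where
  "tetra_degree x =
     (THE n. \<exists>\<phi>. tetra_pi1_identification (x 1) \<phi> \<and>
        \<phi> (induced_map tetrablock_bd x (path_class (sphere 0 1) circle_loop)) = int n)"

definition conj_reflect :: "nat \<Rightarrow> complex poly \<Rightarrow> complex poly" where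
  "conj_reflect n f = (\<Sum>k\<le>n. monom (cnj (coeff f k)) (n - k))"

lemma poly_conj_reflect:
  assumes "degree f \<le> n" "z \<noteq> 0"
  shows "poly (conj_reflect n f) z = z ^ n * cnj (poly f (1 / cnj z))"
proof -
  have "poly f (1 / cnj z) = (\<Sum>k\<le>n. coeff f k * (1 / cnj z) ^ k)"
    unfolding poly_altdef using assms(1)
    by (intro sum.mono_neutral_left) (auto simp: coeff_eq_0)
  hence "z ^ n * cnj (poly f (1 / cnj z)) = (\<Sum>k\<le>n. z ^ n * (cnj (coeff f k) * (1 / z) ^ k))"
    by (simp add: sum_distrib_left)
  also have "\<dots> = (\<Sum>k\<le>n. cnj (coeff f k) * z ^ (n - k))"
    using assms(2) by (intro sum.cong) (auto simp: power_diff field_simps)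
  finally show ?thesis
    by (simp add: conj_reflect_def poly_sum poly_monom)
qed

definition tetra_representation ::
    "(complex \<Rightarrow> complex \<times> complex \<times> complex) \<Rightarrow> complex poly \<Rightarrow> complex poly \<Rightarrow> complex poly \<Rightarrow> bool"
  where "tetra_representation x E1 E2 D \<longleftrightarrow>
     (let n = tetra_degree x in
        degree E1 \<le> n \<and> degree E2 \<le> n \<and> degree D \<le> n \<and>
        (\<forall>z\<in>cball 0 1. poly D z \<noteq> 0 \<and>
           x z = (poly E1 z / poly D z, poly E2 z / poly D z,
                  poly (conj_reflect n D) z / poly D z)))"

text \<open>The representing polynomials are unique up to a common nonzero real factor, so the choice
  made here affects the royal polynomial only by a positive factor, and its zeros not at all.\<close>

definition royal_polynomial :: "(complex \<Rightarrow> complex \<times> complex \<times> complex) \<Rightarrow> complex poly" where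
  "royal_polynomial x =
     (let (E1, E2, D) = (SOME (E1, E2, D). tetra_representation x E1 E2 D)
      in conj_reflect (tetra_degree x) D * D - E1 * E2)"

definition royal_nodes :: "(complex \<Rightarrow> complex \<times> complex \<times> complex) \<Rightarrow> complex set" where
  "royal_nodes x = {\<sigma> \<in> cball 0 1. x \<sigma> \<in> royal_variety}"

text \<open>Only meaningful when the royal polynomial is nonzero, that is, when \<open>x\<close> does not map the
  closed disc into the royal variety.\<close>

definition royal_multiplicity ::
    "(complex \<Rightarrow> complex \<times> complex \<times> complex) \<Rightarrow> complex \<Rightarrow> real" where
  "royal_multiplicity x \<sigma> =
     (if norm \<sigma> < 1 then real (Polynomial.order \<sigma> (royal_polynomial x))
      else real (Polynomial.order \<sigma> (royal_polynomial x)) / 2)"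

end

theory Submission
  imports
    Defs
    "HOL-Complex_Analysis.Riemann_Mapping"
    "HOL-Computational_Algebra.Field_as_Ring"
    "HOL-Computational_Algebra.Polynomial_Factorial"
    "HOL-Computational_Algebra.Fundamental_Theorem_Algebra"
begin

text \<open>On the unit circle an inner function satisfies \<open>x\<^sub>1 = cnj x\<^sub>2 * x\<^sub>3\<close> and \<open>norm x\<^sub>3 = 1\<close>. If
  \<open>x = (E\<^sub>1/D, E\<^sub>2/D, D'/D)\<close>, with \<open>D'\<close> the reflection \<open>z \<mapsto> z\<^sup>n cnj (D (1/cnj z))\<close>, these relations
  say that \<open>E\<^sub>1\<close> and \<open>E\<^sub>2\<close> are each other's reflections, so that the royal polynomial
  \<open>R = D' D - E\<^sub>1 E\<^sub>2\<close> equals its own reflection with respect to the formal degree \<open>2n\<close>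
  (\<open>royal_polynomial_self_inversive\<close>). The zeros of such a polynomial are symmetric under
  \<open>a \<mapsto> 1/cnj a\<close>, where \<open>0\<close> is exchanged with the missing \<open>2n - degree R\<close> zeros at infinity. Hence
  the zeros in the open disc together with half of those on the circle number exactly \<open>n\<close>
  (\<open>self_inversive_root_count\<close>), and it remains to see that \<open>x\<close> has a representation whose formal
  degree \<open>n\<close> is the topological degree of \<open>x\<close>.

  A representation exists for some \<open>n\<close> (\<open>exists_representation_of_degree\<close>): in lowest terms
  \<open>x\<^sub>3 = p/q\<close> is unimodular on the circle, which forces the reflection of \<open>q\<close> to be a unimodular
  multiple of \<open>p\<close>. A rotation of \<open>q\<close> by a square root of that multiple gives \<open>D\<close>. The relation
  \<open>x\<^sub>1 = cnj x\<^sub>2 * x\<^sub>3\<close> then shows that the denominators of \<open>x\<^sub>1\<close> and \<open>x\<^sub>2\<close> divide \<open>D\<close>.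

  For any representation, \<open>n\<close> is the topological degree
  (\<open>tetra_degree_eq_representation_degree\<close>). The first coordinate of a point of the distinguished
  boundary is determined by the other two, which range over a disc times a circle. The disc is
  convex, so homotopy classes of loops, and of paths with given end points, are classified by the
  winding number of the third coordinate, and this is the only identification of the fundamental group with the integers that
  has the required orientation. Finally, \<open>x\<^sub>3 = z\<^sup>n cnj (D z) / D z\<close> on the circle, and shrinking the
  argument of \<open>D\<close> to \<open>0\<close> deforms this, without zeros, to a constant multiple of \<open>z\<^sup>n\<close>.\<close>

section \<open>Conjugate reflection of polynomials\<close>

lemma coeff_conj_reflect:
  "coeff (conj_reflect n f) j = (if j \<le> n then cnj (coeff f (n - j)) else 0)"
proof -
  have "coeff (conj_reflect n f) j = (\<Sum>k\<le>n. if n - k = j then cnj (coeff f k) else 0)"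
    by (simp add: conj_reflect_def coeff_sum)
  also have "\<dots> = (\<Sum>k\<le>n. if k = n - j then (if j \<le> n then cnj (coeff f k) else 0) else 0)"
    by (intro sum.cong) auto
  finally show ?thesis by simp
qed

lemma degree_conj_reflect_le: "degree (conj_reflect n f) \<le> n"
  by (rule degree_le) (simp add: coeff_conj_reflect)

lemma conj_reflect_conj_reflect: "degree f \<le> n \<Longrightarrow> conj_reflect n (conj_reflect n f) = f"
  by (rule poly_eqI) (auto simp: coeff_conj_reflect coeff_eq_0)

lemma conj_reflect_eq_0_iff:
  assumes deg: "degree f \<le> n"
  shows "conj_reflect n f = 0 \<longleftrightarrow> f = 0"
proof
  assume "conj_reflect n f = 0"
  hence "conj_reflect n 0 = f" using conj_reflect_conj_reflect[OF deg] by simp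
  thus "f = 0" by (simp add: conj_reflect_def)
qed (simp add: conj_reflect_def)

lemma cnj_inverse_on_circle:
  fixes z :: complex
  assumes "z \<in> sphere 0 1"
  shows "1 / cnj z = z"
proof -
  have "z * cnj z = 1" "z \<noteq> 0" using assms by (auto simp: complex_norm_square[symmetric])
  thus ?thesis by (simp add: field_simps)
qed

text \<open>Reflection \<open>z \<mapsto> 1/cnj z\<close> fixes the unit circle, so there the reflected polynomial is just
  \<open>z\<^sup>n\<close> times the conjugate. Since polynomials that agree on the circle are equal, this turns
  relations between boundary values into polynomial identities.\<close>

lemma poly_conj_reflect_on_circle:
  assumes "degree f \<le> n" "z \<in> sphere 0 1"
  shows "poly (conj_reflect n f) z = z ^ n * cnj (poly f z)"
proof -
  have "z \<noteq> 0" using assms(2) by auto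
  thus ?thesis
    using poly_conj_reflect[OF assms(1), of z] cnj_inverse_on_circle[OF assms(2)] by simp
qed

lemma poly_eq_on_infinite:
  fixes p q :: "'a::idom poly"
  assumes "infinite S" "\<And>z. z \<in> S \<Longrightarrow> poly p z = poly q z"
  shows "p = q"
proof (rule ccontr)
  assume "p \<noteq> q"
  hence "finite {z. poly (p - q) z = 0}" by (intro poly_roots_finite) auto
  moreover have "S \<subseteq> {z. poly (p - q) z = 0}" using assms(2) by auto
  ultimately show False using assms(1) finite_subset by blast
qed

lemma infinite_unit_circle: "infinite (sphere (0::complex) 1)"
proof
  assume "finite (sphere (0::complex) 1)"
  moreover have "connected (sphere (0::complex) 1)" by (rule connected_sphere) simp
  ultimately obtain a where "sphere (0::complex) 1 = {} \<or> sphere (0::complex) 1 = {a}"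
    using connected_finite_iff_sing[of "sphere (0::complex) 1"] by blast
  moreover have "1 \<in> sphere (0::complex) 1" "-1 \<in> sphere (0::complex) 1" by auto
  ultimately have "(1::complex) = -1" by (metis emptyE singletonD)
  thus False by simp
qed

lemmas poly_eq_on_circle = poly_eq_on_infinite[OF infinite_unit_circle]

lemma conj_reflect_mult:
  assumes "degree f \<le> m" "degree g \<le> n"
  shows "conj_reflect (m + n) (f * g) = conj_reflect m f * conj_reflect n g"
proof (rule poly_eq_on_circle)
  fix z :: complex assume z: "z \<in> sphere 0 1"
  have "degree (f * g) \<le> m + n"
    using assms degree_mult_le[of f g] by linarith
  thus "poly (conj_reflect (m + n) (f * g)) z = poly (conj_reflect m f * conj_reflect n g) z"
    using assms z by (simp add: poly_conj_reflect_on_circle power_add mult_ac)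
qed

text \<open>Reflection is multiplicative and sends \<open>X - b\<close> with \<open>b = 1/cnj a\<close> to a nonzero multiple of
  \<open>X - a\<close>, so powers of \<open>X - b\<close> dividing \<open>f\<close> become powers of \<open>X - a\<close> dividing the reflection.\<close>

lemma order_le_order_conj_reflect:
  assumes "degree f \<le> n" "f \<noteq> 0" "a \<noteq> 0"
  shows "Polynomial.order (1 / cnj a) f \<le> Polynomial.order a (conj_reflect n f)"
proof -
  define b where "b = 1 / cnj a"
  define k where "k = Polynomial.order b f"
  obtain g where g: "f = [:-b, 1:] ^ k * g"
    using order_1[of b f] unfolding k_def dvd_def by blast
  hence "g \<noteq> 0" using assms(2) by auto
  hence deg: "degree f = k + degree g"
    by (subst g) (simp add: degree_mult_eq degree_power_eq)
  have lin: "conj_reflect k ([:-b, 1:] ^ k) = smult ((- cnj b) ^ k) ([:-a, 1:] ^ k)"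
  proof (rule poly_eq_on_circle)
    fix z :: complex assume z: "z \<in> sphere 0 1"
    have "z * cnj z = 1" using z by (simp add: complex_norm_square[symmetric])
    \<comment> \<open>on the circle \<open>cnj z = 1/z\<close>, and \<open>cnj b = 1/a\<close>\<close>
    hence "z * (cnj z - cnj b) = - cnj b * (z - a)"
      using assms(3) by (simp add: b_def field_simps)
    hence "z ^ k * (cnj z - cnj b) ^ k = (- cnj b) ^ k * (z - a) ^ k"
      by (metis power_mult_distrib)
    thus "poly (conj_reflect k ([:-b, 1:] ^ k)) z = poly (smult ((- cnj b) ^ k) ([:-a, 1:] ^ k)) z"
      using z by (simp add: poly_conj_reflect_on_circle degree_power_eq)
  qed
  have "conj_reflect n f = conj_reflect (k + (n - k)) ([:-b, 1:] ^ k * g)"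
    using g deg assms(1) by simp
  also have "\<dots> = conj_reflect k ([:-b, 1:] ^ k) * conj_reflect (n - k) g"
    using deg assms(1) by (intro conj_reflect_mult) (auto simp: degree_power_eq)
  finally have "[:-a, 1:] ^ k dvd conj_reflect n f"
    unfolding lin by (auto intro: dvd_mult2 dvd_smult)
  moreover have "conj_reflect n f \<noteq> 0"
    using assms by (simp add: conj_reflect_eq_0_iff)
  ultimately show ?thesis
    by (simp add: order_divides k_def b_def)
qed

text \<open>Equality follows from the inequality because reflection is an involution.\<close>

lemma order_conj_reflect:
  assumes "degree f \<le> n" "f \<noteq> 0" "a \<noteq> 0"
  shows "Polynomial.order a (conj_reflect n f) = Polynomial.order (1 / cnj a) f"
proof (rule antisym)
  have "Polynomial.order (1 / cnj (1 / cnj a)) (conj_reflect n f) \<le>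
          Polynomial.order (1 / cnj a) (conj_reflect n (conj_reflect n f))"
    using assms by (intro order_le_order_conj_reflect)
      (auto simp: degree_conj_reflect_le conj_reflect_eq_0_iff)
  thus "Polynomial.order a (conj_reflect n f) \<le> Polynomial.order (1 / cnj a) f"
    using assms by (simp add: conj_reflect_conj_reflect)
qed (rule order_le_order_conj_reflect[OF assms])

section \<open>Zeros of self-inversive polynomials\<close>

text \<open>The coefficients \<open>k\<close> and \<open>m - k\<close> are conjugate to each other, so as many top coefficients (up to
  the formal degree \<open>m\<close>) vanish as bottom ones. In the symmetry \<open>a \<mapsto> 1/cnj a\<close> of the zeros this is
  the exchange of \<open>0\<close> and infinity.\<close>

lemma degree_self_inversive:
  assumes "conj_reflect m f = f" "f \<noteq> 0"
  shows "degree f + Polynomial.order 0 f = m"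
proof -
  define k where "k = Polynomial.order 0 f"
  have low: "coeff f j = 0" if "j < k" for j
    using monom_1_dvd_iff[OF assms(2), of k] monom_1_dvd_iff'[of k f] that by (auto simp: k_def)
  have "\<not> monom 1 (Suc k) dvd f"
    using monom_1_dvd_iff[OF assms(2), of "Suc k"] by (simp add: k_def)
  hence k: "coeff f k \<noteq> 0"
    using low by (auto simp: monom_1_dvd_iff' less_Suc_eq)
  have sym: "coeff f j = (if j \<le> m then cnj (coeff f (m - j)) else 0)" for j
    using coeff_conj_reflect[of m f j] assms(1) by simp
  have "k \<le> m" using k sym[of k] by (auto split: if_splits)
  have "degree f = m - k"
  proof (rule antisym)
    show "degree f \<le> m - k"
    proof (rule degree_le, intro allI impI)
      fix j assume "m - k < j"
      thus "coeff f j = 0" using sym[of j] low[of "m - j"] by auto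
    qed
    show "m - k \<le> degree f"
      by (rule le_degree) (use k sym[of "m - k"] \<open>k \<le> m\<close> in simp)
  qed
  thus ?thesis using \<open>k \<le> m\<close> by (simp add: k_def)
qed

lemma sum_order_eq_degree:
  fixes p :: "complex poly"
  assumes "p \<noteq> 0"
  shows "(\<Sum>a | poly p a = 0. Polynomial.order a p) = degree p"
  using assms size_proots_complex[of p] by (simp add: size_multiset_overloaded_eq)

text \<open>Write \<open>m\<close> for the order at \<open>0\<close>, \<open>i\<close> for the number of other zeros in the open disc and \<open>t\<close> for the
  number of zeros on the circle. By symmetry there are also \<open>i\<close> zeros outside the closed disc, and
  the degree is \<open>2n - m\<close>. Hence \<open>m + 2i + t = 2n - m\<close>, which is \<open>(m + i) + t/2 = n\<close>.\<close>

lemma self_inversive_root_count: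
  fixes f :: "complex poly"
  assumes "conj_reflect (2 * n) f = f" "f \<noteq> 0"
  shows "(\<Sum>a | a \<in> cball 0 1 \<and> poly f a = 0.
            if norm a < 1 then real (Polynomial.order a f) else real (Polynomial.order a f) / 2) = real n"
proof -
  define o' where "o' a = real (Polynomial.order a f)" for a
  define Z where "Z = {a. poly f a = 0}"
  define I where "I = {a \<in> Z. norm a < 1}"
  define T where "T = {a \<in> Z. norm a = 1}"
  define X where "X = {a \<in> Z. norm a > 1}"
  have deg: "degree f \<le> 2 * n" using degree_conj_reflect_le[of "2 * n" f] assms(1) by simp
  have fin: "finite Z" using assms(2) by (simp add: Z_def poly_roots_finite)
  hence fins: "finite I" "finite T" "finite X" by (auto simp: I_def T_def X_def)
  have sym: "o' (1 / cnj a) = o' a" if "a \<noteq> 0" for a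
    using order_conj_reflect[OF deg assms(2) that] assms(1) by (simp add: o'_def)
  have Z_iff: "a \<in> Z \<longleftrightarrow> o' a \<noteq> 0" for a
    using assms(2) by (auto simp: Z_def o'_def order_root)
  have "sum o' X = sum o' (I - {0})"
  proof (rule sum.reindex_bij_witness[where i = "\<lambda>a. 1 / cnj a" and j = "\<lambda>a. 1 / cnj a"])
    fix a assume a: "a \<in> X"
    hence "a \<noteq> 0" by (auto simp: X_def)
    thus "1 / cnj (1 / cnj a) = a" "1 / cnj a \<in> I - {0}" "o' (1 / cnj a) = o' a"
      using a sym[of a] by (auto simp: X_def I_def Z_iff norm_divide)
  next
    fix a assume a: "a \<in> I - {0}"
    thus "1 / cnj (1 / cnj a) = a" "1 / cnj a \<in> X"
      using sym[of a] by (auto simp: X_def I_def Z_iff norm_divide)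
  qed
  moreover have "sum o' I = o' 0 + sum o' (I - {0})"
    using fins(1) by (cases "0 \<in> I") (auto simp: sum.remove I_def Z_iff)
  moreover have "sum o' Z = real (degree f)"
    using arg_cong[OF sum_order_eq_degree[OF assms(2)], of real] by (simp add: o'_def Z_def)
  moreover have "sum o' Z = sum o' I + sum o' T + sum o' X"
  proof -
    have "Z = (I \<union> T) \<union> X" by (auto simp: I_def T_def X_def)
    moreover have "sum o' ((I \<union> T) \<union> X) = sum o' (I \<union> T) + sum o' X"
      using fins by (intro sum.union_disjoint) (auto simp: I_def T_def X_def)
    moreover have "sum o' (I \<union> T) = sum o' I + sum o' T"
      using fins by (intro sum.union_disjoint) (auto simp: I_def T_def)
    ultimately show ?thesis by simp
  qed
  moreover have "real (degree f) + o' 0 = 2 * real n"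
    using arg_cong[OF degree_self_inversive[OF assms], of real] by (simp add: o'_def)
  ultimately have "sum o' I + sum o' T / 2 = real n" by simp
  moreover have "(\<Sum>a | a \<in> cball 0 1 \<and> poly f a = 0. if norm a < 1 then o' a else o' a / 2)
      = sum o' I + sum o' T / 2"
  proof -
    have "{a. a \<in> cball 0 1 \<and> poly f a = 0} = I \<union> T"
      by (auto simp: I_def T_def Z_def)
    hence "(\<Sum>a | a \<in> cball 0 1 \<and> poly f a = 0. if norm a < 1 then o' a else o' a / 2)
      = (\<Sum>a\<in>I. if norm a < 1 then o' a else o' a / 2) + (\<Sum>a\<in>T. if norm a < 1 then o' a else o' a / 2)"
      using fins by (simp only:) (intro sum.union_disjoint, auto simp: I_def T_def)
    also have "(\<Sum>a\<in>I. if norm a < 1 then o' a else o' a / 2) = sum o' I"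
      by (rule sum.cong) (auto simp: I_def)
    also have "(\<Sum>a\<in>T. if norm a < 1 then o' a else o' a / 2) = sum o' T / 2"
      unfolding sum_divide_distrib by (rule sum.cong) (auto simp: T_def)
    finally show ?thesis .
  qed
  ultimately show ?thesis unfolding o'_def by simp
qed

section \<open>Fractions with unimodular boundary values\<close>

lemma coprimeI_no_common_root:
  fixes p q :: "complex poly"
  assumes "\<And>a. poly p a = 0 \<Longrightarrow> poly q a \<noteq> 0"
  shows "coprime p q"
proof (rule coprimeI)
  fix d assume d: "d dvd p" "d dvd q"
  have no_root: "poly d a \<noteq> 0" for a
    using assms[of a] d by (metis dvd_def mult_zero_left poly_mult)
  hence "degree d = 0" using alg_closed_imp_poly_has_root[of d] by blast
  moreover have "d \<noteq> 0" using no_root[of 0] by auto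
  ultimately show "is_unit d" by (simp add: is_unit_iff_degree)
qed

text \<open>A common zero \<open>a \<noteq> 0\<close> of the reflections gives the common zero \<open>1/cnj a\<close> of \<open>p\<close> and \<open>q\<close>. The
  choice of \<open>n\<close> excludes a common zero at \<open>0\<close>: the constant terms of the reflections are the
  conjugated coefficients of \<open>p\<close> and \<open>q\<close> at \<open>n\<close>, and one of these is a leading coefficient.\<close>

lemma coprime_conj_reflect:
  assumes "coprime p q" and n: "n = max (degree p) (degree q)"
  shows "coprime (conj_reflect n p) (conj_reflect n q)"
proof (rule coprimeI_no_common_root, rule notI)
  fix a assume a: "poly (conj_reflect n p) a = 0" "poly (conj_reflect n q) a = 0"
  show False
  proof (cases "a = 0")
    case False
    hence "poly p (1 / cnj a) = 0" "poly q (1 / cnj a) = 0"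
      using a n by (auto simp: poly_conj_reflect)
    thus False using coprime_poly_0[OF assms(1)] by blast
  next
    case True
    hence "coeff p n = 0" "coeff q n = 0"
      using a by (auto simp: poly_0_coeff_0 coeff_conj_reflect)
    hence "lead_coeff p = 0 \<or> lead_coeff q = 0"
      using n by (simp add: max_def split: if_splits)
    hence "p = 0 \<or> q = 0" by simp
    hence "n = 0"
    proof
      assume "p = 0"
      hence "is_unit q" using assms(1) by simp
      then obtain c where "q = [:c:]" by (rule is_unit_polyE)
      thus ?thesis using n \<open>p = 0\<close> by simp
    next
      assume "q = 0"
      hence "is_unit p" using assms(1) by simp
      then obtain c where "p = [:c:]" by (rule is_unit_polyE)
      thus ?thesis using n \<open>q = 0\<close> by simp
    qed
    hence "p = 0 \<and> q = 0"
      using \<open>coeff p n = 0\<close> \<open>coeff q n = 0\<close> n leading_coeff_0_iff[of p] leading_coeff_0_iff[of q]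
      by simp
    thus False using assms(1) by simp
  qed
qed

text \<open>This is the algebraic form of a finite Blaschke product. With \<open>p'\<close> and \<open>q'\<close> the reflections,
  equality of the moduli on the circle means \<open>p p' = q q'\<close>. As \<open>p\<close> is coprime to \<open>q\<close> and \<open>p'\<close> to \<open>q'\<close>,
  the polynomials \<open>p\<close> and \<open>q'\<close> divide each other.\<close>

lemma conj_reflect_unimodular_fraction:
  assumes "coprime p q" and n: "n = max (degree p) (degree q)"
    and nz: "\<And>z. z \<in> sphere 0 1 \<Longrightarrow> poly q z \<noteq> 0"
    and unimod: "\<And>z. z \<in> sphere 0 1 \<Longrightarrow> norm (poly p z) = norm (poly q z)"
  shows "\<exists>c. norm c = 1 \<and> conj_reflect n q = smult c p"
proof -
  have deg: "degree p \<le> n" "degree q \<le> n" using n by auto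
  have eq: "p * conj_reflect n p = q * conj_reflect n q"
  proof (rule poly_eq_on_circle)
    fix z :: complex assume z: "z \<in> sphere 0 1"
    have "poly p z * cnj (poly p z) = poly q z * cnj (poly q z)"
      using unimod[OF z] by (simp add: complex_norm_square[symmetric])
    thus "poly (p * conj_reflect n p) z = poly (q * conj_reflect n q) z"
      using z deg by (simp add: poly_conj_reflect_on_circle mult.left_commute)
  qed
  have "poly p 1 \<noteq> 0" using nz[of 1] unimod[of 1] by auto
  hence "p \<noteq> 0" by auto
  have "p dvd q * conj_reflect n q" using eq by (metis dvd_triv_left)
  hence "p dvd conj_reflect n q"
    using assms(1) by (simp add: coprime_dvd_mult_right_iff)
  then obtain h where h: "conj_reflect n q = p * h" by (rule dvdE)
  have "conj_reflect n q dvd p * conj_reflect n p" using eq by simp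
  moreover have "coprime (conj_reflect n q) (conj_reflect n p)"
    using coprime_conj_reflect[OF assms(1) n] by (simp add: coprime_commute)
  ultimately have "conj_reflect n q dvd p"
    by (simp add: coprime_dvd_mult_left_iff)
  then obtain k where "p = p * (h * k)" using h by (metis dvd_def mult.assoc)
  hence "h * k = 1" using \<open>p \<noteq> 0\<close> by simp
  hence "is_unit h" by (metis dvd_triv_left)
  then obtain c where c: "h = [:c:]" by (auto simp: is_unit_poly_iff)
  have "norm (poly (conj_reflect n q) 1) = norm (poly q 1)"
    using deg by (subst poly_conj_reflect_on_circle) auto
  hence "norm c * norm (poly p 1) = norm (poly p 1)"
    using unimod[of 1] h c by (simp add: norm_mult)
  hence "norm c = 1" using \<open>poly p 1 \<noteq> 0\<close> by simp
  thus ?thesis using h c by auto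
qed

text \<open>The zeros of \<open>p\<close> lie outside the closed disc, those of the reflection of \<open>q\<close> in the open disc.\<close>

lemma coprime_conj_reflect_zero_free:
  assumes "degree q \<le> m"
    and "\<And>z. z \<in> cball 0 1 \<Longrightarrow> poly p z \<noteq> 0" "\<And>z. z \<in> cball 0 1 \<Longrightarrow> poly q z \<noteq> 0"
  shows "coprime p (conj_reflect m q)"
proof (rule coprimeI_no_common_root)
  fix a assume "poly p a = 0"
  hence "a \<notin> cball 0 1" using assms(2)[of a] by blast
  hence a: "norm a > 1" by simp
  hence "a \<noteq> 0" by auto
  moreover have "1 / cnj a \<in> cball 0 1" using a by (simp add: norm_divide divide_le_eq_1)
  ultimately show "poly (conj_reflect m q) a \<noteq> 0"
    using assms(3)[of "1 / cnj a"] by (simp add: poly_conj_reflect[OF assms(1)])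
qed

text \<open>The boundary relation, cleared of denominators, makes \<open>q\<^sub>1\<close> divide \<open>D\<close> times the reflection of
  \<open>q\<^sub>2\<close>, and by the location of the zeros \<open>q\<^sub>1\<close> is coprime to the latter factor.\<close>

lemma denominator_dvd:
  assumes cop: "coprime p1 q1" and deg: "degree D \<le> n"
    and q1: "\<And>z. z \<in> cball 0 1 \<Longrightarrow> poly q1 z \<noteq> 0"
    and q2: "\<And>z. z \<in> cball 0 1 \<Longrightarrow> poly q2 z \<noteq> 0"
    and D: "\<And>z. z \<in> cball 0 1 \<Longrightarrow> poly D z \<noteq> 0"
    and eq: "\<And>z. z \<in> sphere 0 1 \<Longrightarrow> poly p1 z / poly q1 z =
               cnj (poly p2 z / poly q2 z) * (poly (conj_reflect n D) z / poly D z)"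
  shows "q1 dvd D"
proof -
  define m where "m = max (degree p2) (degree q2)"
  have m: "degree p2 \<le> m" "degree q2 \<le> m" by (auto simp: m_def)
  have "p1 * (conj_reflect m q2 * D) = conj_reflect m p2 * conj_reflect n D * q1"
  proof (rule poly_eq_on_circle)
    fix z :: complex assume z: "z \<in> sphere 0 1"
    have "poly q1 z \<noteq> 0" "poly q2 z \<noteq> 0" "poly D z \<noteq> 0"
      using z q1[of z] q2[of z] D[of z] by auto
    hence "poly p1 z * cnj (poly q2 z) * poly D z =
             cnj (poly p2 z) * poly (conj_reflect n D) z * poly q1 z"
      using eq[OF z] by (simp add: field_simps)
    thus "poly (p1 * (conj_reflect m q2 * D)) z = poly (conj_reflect m p2 * conj_reflect n D * q1) z"
      using z m by (simp add: poly_conj_reflect_on_circle[of _ m] mult.assoc)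
  qed
  hence "q1 dvd p1 * (conj_reflect m q2 * D)" by simp
  hence "q1 dvd conj_reflect m q2 * D"
    using cop by (simp add: coprime_dvd_mult_right_iff coprime_commute)
  moreover have "coprime q1 (conj_reflect m q2)"
    using coprime_conj_reflect_zero_free[OF m(2) q1 q2] .
  ultimately show ?thesis by (simp add: coprime_dvd_mult_right_iff)
qed

text \<open>On the circle \<open>z\<^sup>n cnj (F z)\<close> is a Laurent polynomial in \<open>z\<close> with no powers above \<open>z\<^sup>n\<close>, but perhaps
  with negative ones. Multiplication by \<open>z\<^sup>M\<close>, where \<open>M = degree F\<close>, gives an identity of
  polynomials.\<close>

lemma degree_le_if_reflection_on_circle:
  assumes "\<And>z. z \<in> sphere 0 1 \<Longrightarrow> poly E z = z ^ n * cnj (poly F z)"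
  shows "degree E \<le> n"
proof (cases "E = 0")
  case False
  define M where "M = degree F"
  have eq: "monom 1 M * E = monom 1 n * conj_reflect M F"
  proof (rule poly_eq_on_circle)
    fix z :: complex assume z: "z \<in> sphere 0 1"
    show "poly (monom 1 M * E) z = poly (monom 1 n * conj_reflect M F) z"
      using assms[OF z] z by (simp add: poly_monom poly_conj_reflect_on_circle M_def mult_ac)
  qed
  have "M + degree E = degree (monom 1 M * E)"
    using False by (simp add: degree_mult_eq degree_monom_eq)
  also have "\<dots> \<le> n + M"
    unfolding eq using degree_mult_le[of "monom 1 n" "conj_reflect M F"]
      degree_conj_reflect_le[of M F] degree_monom_le[of "1::complex" n] by linarith
  finally show ?thesis by simp
qed simp

text \<open>Continuity on the closed disc extends \<open>q f = p\<close> to the circle. A zero of \<open>q\<close> there would then be a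
  zero of \<open>p\<close> as well, which lowest terms exclude.\<close>

lemma rational_on_reduced_fraction:
  assumes "rational_on (ball 0 1) f" "continuous_on (cball 0 1) f"
  obtains p q where "coprime p q" "\<And>z. z \<in> cball 0 1 \<Longrightarrow> poly q z \<noteq> 0"
    "\<And>z. z \<in> cball 0 1 \<Longrightarrow> f z = poly p z / poly q z"
proof -
  obtain p0 q0 where pq0: "\<And>z. z \<in> ball 0 1 \<Longrightarrow> poly q0 z \<noteq> 0"
      "\<And>z. z \<in> ball 0 1 \<Longrightarrow> f z = poly p0 z / poly q0 z"
    using assms(1) unfolding rational_on_def by blast
  define g where "g = gcd p0 q0"
  have "q0 \<noteq> 0" using pq0(1)[of 0] by auto
  hence "g \<noteq> 0" by (simp add: g_def)
  then obtain p q where pq: "p0 = p * g" "q0 = q * g" "coprime p q"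
    using gcd_coprime_exists[of p0 q0] unfolding g_def by blast
  have "poly q z * f z - poly p z = 0" if "z \<in> cball 0 1" for z
  proof (rule continuous_constant_on_closure[of "ball 0 1" "\<lambda>z. poly q z * f z - poly p z"])
    show "continuous_on (closure (ball 0 1)) (\<lambda>z. poly q z * f z - poly p z)"
      using assms(2) by (auto intro!: continuous_intros)
    show "z \<in> closure (ball 0 1)" using that by simp
    fix w :: complex assume "w \<in> ball 0 1"
    thus "poly q w * f w - poly p w = 0" using pq0[of w] pq by auto
  qed
  hence eq: "poly q z * f z = poly p z" if "z \<in> cball 0 1" for z using that by force
  have nz: "poly q z \<noteq> 0" if "z \<in> cball 0 1" for z
    using eq[OF that] coprime_poly_0[OF pq(3), of z] by auto
  show ?thesis
  proof (rule that[OF pq(3) nz])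
    show "f z = poly p z / poly q z" if "z \<in> cball 0 1" for z
      using eq[OF that] nz[OF that] by (simp add: field_simps)
  qed
qed

section \<open>Polynomial representation of inner functions\<close>

text \<open>The formal degree \<open>n\<close> is a parameter here because a representation can be constructed before the
  topological degree of \<open>x\<close> is known.\<close>

definition representation_of_degree ::
    "nat \<Rightarrow> (complex \<Rightarrow> complex \<times> complex \<times> complex) \<Rightarrow>
     complex poly \<Rightarrow> complex poly \<Rightarrow> complex poly \<Rightarrow> bool"
  where "representation_of_degree n x E1 E2 D \<longleftrightarrow>
     degree E1 \<le> n \<and> degree E2 \<le> n \<and> degree D \<le> n \<and>
     (\<forall>z\<in>cball 0 1. poly D z \<noteq> 0 \<and>
        x z = (poly E1 z / poly D z, poly E2 z / poly D z,
               poly (conj_reflect n D) z / poly D z))"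

text \<open>As \<open>cnj c = 1/c\<close>, the relation between the first two coordinates is symmetric in them.\<close>

lemma inner_on_circle:
  assumes "rational_tetra_inner x" "z \<in> sphere 0 1" "x z = (a, b, c)"
  shows "a = cnj b * c" "b = cnj a * c" "norm c = 1"
proof -
  have "x z \<in> tetrablock_bd" using assms unfolding rational_tetra_inner_def by blast
  thus *: "a = cnj b * c" "norm c = 1"
    using assms(3) by (auto simp: tetrablock_bd_def)
  have "c * cnj c = 1" using *(2) by (simp add: complex_norm_square[symmetric])
  thus "b = cnj a * c" using *(1) by (simp add: mult.commute mult.left_commute)
qed

text \<open>The third component \<open>p\<^sub>3/q\<^sub>3\<close> determines \<open>D\<close>, as the rotation of \<open>q\<^sub>3\<close> whose reflection is the same
  multiple of \<open>p\<^sub>3\<close>, and \<open>n\<close>, as the larger degree of \<open>p\<^sub>3\<close> and \<open>q\<^sub>3\<close>. The boundary relations between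
  the components then leave no freedom for other denominators or larger degrees in the first two.\<close>

lemma exists_representation_of_degree:
  assumes x: "rational_tetra_inner x"
  obtains n E1 E2 D where "representation_of_degree n x E1 E2 D"
proof -
  have rat: "rational_on (ball 0 1) (\<lambda>z. fst (x z))" "rational_on (ball 0 1) (\<lambda>z. fst (snd (x z)))"
      "rational_on (ball 0 1) (\<lambda>z. snd (snd (x z)))" and cont: "continuous_on (cball 0 1) x"
    using x unfolding rational_tetra_inner_def by auto
  obtain p1 q1 where 1: "coprime p1 q1" "\<And>z. z \<in> cball 0 1 \<Longrightarrow> poly q1 z \<noteq> 0"
      "\<And>z. z \<in> cball 0 1 \<Longrightarrow> fst (x z) = poly p1 z / poly q1 z"
    using rational_on_reduced_fraction[OF rat(1) continuous_on_fst[OF cont]] by blast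
  obtain p2 q2 where 2: "coprime p2 q2" "\<And>z. z \<in> cball 0 1 \<Longrightarrow> poly q2 z \<noteq> 0"
      "\<And>z. z \<in> cball 0 1 \<Longrightarrow> fst (snd (x z)) = poly p2 z / poly q2 z"
    using rational_on_reduced_fraction[OF rat(2) continuous_on_fst[OF continuous_on_snd[OF cont]]] by blast
  obtain p3 q3 where 3: "coprime p3 q3" "\<And>z. z \<in> cball 0 1 \<Longrightarrow> poly q3 z \<noteq> 0"
      "\<And>z. z \<in> cball 0 1 \<Longrightarrow> snd (snd (x z)) = poly p3 z / poly q3 z"
    using rational_on_reduced_fraction[OF rat(3) continuous_on_snd[OF continuous_on_snd[OF cont]]] by blast
  define n where "n = max (degree p3) (degree q3)"
  have circle_ball: "z \<in> cball 0 1" if "z \<in> sphere 0 1" for z :: complex using that by simp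
  have on_circle: "fst (x z) = cnj (fst (snd (x z))) * snd (snd (x z))"
      "fst (snd (x z)) = cnj (fst (x z)) * snd (snd (x z))"
      "norm (snd (snd (x z))) = 1" if "z \<in> sphere 0 1" for z
  proof -
    have "x z = (fst (x z), fst (snd (x z)), snd (snd (x z)))" by simp
    from inner_on_circle[OF x that this] show
      "fst (x z) = cnj (fst (snd (x z))) * snd (snd (x z))"
      "fst (snd (x z)) = cnj (fst (x z)) * snd (snd (x z))"
      "norm (snd (snd (x z))) = 1" by blast+
  qed
  have "norm (poly p3 z) = norm (poly q3 z)" if z: "z \<in> sphere 0 1" for z
    using on_circle(3)[OF z] 3(2,3)[OF circle_ball[OF z]] by (simp add: norm_divide)
  then obtain c where c: "norm c = 1" "conj_reflect n q3 = smult c p3"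
    using conj_reflect_unimodular_fraction[OF 3(1) n_def] 3(2) circle_ball by blast
  \<comment> \<open>\<open>cnj \<mu> * c = \<mu>\<close> makes the quotient of the reflection of \<open>D\<close> by \<open>D\<close> equal to \<open>p3 / q3\<close>\<close>
  define \<mu> where "\<mu> = csqrt c"
  define D where "D = smult \<mu> q3"
  have "norm \<mu> = 1" using c by (simp add: \<mu>_def)
  hence \<mu>: "cnj \<mu> * c = \<mu>" "\<mu> \<noteq> 0"
  proof -
    have "\<mu> * \<mu> = c" by (simp add: \<mu>_def power2_eq_square[symmetric])
    moreover have "cnj \<mu> * \<mu> = 1"
      using \<open>norm \<mu> = 1\<close> by (simp add: complex_norm_square[symmetric] mult.commute)
    ultimately show "cnj \<mu> * c = \<mu>" by (metis mult.assoc mult_1)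
    show "\<mu> \<noteq> 0" using \<open>norm \<mu> = 1\<close> by auto
  qed
  have degD: "degree D \<le> n" by (simp add: D_def n_def)
  have D: "poly D z \<noteq> 0" if "z \<in> cball 0 1" for z
    using 3(2)[OF that] \<mu>(2) by (simp add: D_def)
  have "conj_reflect n D = smult (cnj \<mu>) (conj_reflect n q3)"
    by (rule poly_eqI) (simp add: coeff_conj_reflect D_def)
  hence "conj_reflect n D = smult \<mu> p3" using c(2) \<mu>(1) by simp
  hence x3: "snd (snd (x z)) = poly (conj_reflect n D) z / poly D z" if "z \<in> cball 0 1" for z
    using 3(3)[OF that] \<mu>(2) by (simp add: D_def)
  have "q1 dvd D"
  proof (rule denominator_dvd[OF 1(1) degD 1(2) 2(2) D])
    fix z :: complex assume z: "z \<in> sphere 0 1"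
    show "poly p1 z / poly q1 z = cnj (poly p2 z / poly q2 z) * (poly (conj_reflect n D) z / poly D z)"
      using on_circle(1)[OF z] 1(3) 2(3) x3 circle_ball[OF z] by simp
  qed
  then obtain r1 where r1: "D = q1 * r1" by (rule dvdE)
  have "q2 dvd D"
  proof (rule denominator_dvd[OF 2(1) degD 2(2) 1(2) D])
    fix z :: complex assume z: "z \<in> sphere 0 1"
    show "poly p2 z / poly q2 z = cnj (poly p1 z / poly q1 z) * (poly (conj_reflect n D) z / poly D z)"
      using on_circle(2)[OF z] 1(3) 2(3) x3 circle_ball[OF z] by simp
  qed
  then obtain r2 where r2: "D = q2 * r2" by (rule dvdE)
  define E1 where "E1 = p1 * r1"
  define E2 where "E2 = p2 * r2"
  have x1: "fst (x z) = poly E1 z / poly D z" if "z \<in> cball 0 1" for z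
    using 1(3)[OF that] D[OF that] by (simp add: E1_def r1)
  have x2: "fst (snd (x z)) = poly E2 z / poly D z" if "z \<in> cball 0 1" for z
    using 2(3)[OF that] D[OF that] by (simp add: E2_def r2)
  have "degree E1 \<le> n"
  proof (rule degree_le_if_reflection_on_circle)
    fix z :: complex assume z: "z \<in> sphere 0 1"
    show "poly E1 z = z ^ n * cnj (poly E2 z)"
      using on_circle(1)[OF z] x1 x2 x3 D[of z] circle_ball[OF z] z
      by (simp add: poly_conj_reflect_on_circle[OF degD] field_simps)
  qed
  moreover have "degree E2 \<le> n"
  proof (rule degree_le_if_reflection_on_circle)
    fix z :: complex assume z: "z \<in> sphere 0 1"
    show "poly E2 z = z ^ n * cnj (poly E1 z)"
      using on_circle(2)[OF z] x1 x2 x3 D[of z] circle_ball[OF z] z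
      by (simp add: poly_conj_reflect_on_circle[OF degD] field_simps)
  qed
  ultimately have "representation_of_degree n x E1 E2 D"
    using degD D x1 x2 x3 unfolding representation_of_degree_def
    by (metis prod.collapse)
  thus ?thesis by (rule that)
qed

section \<open>Homotopy in the distinguished boundary\<close>

text \<open>For closed paths in the distinguished boundary this number is a complete homotopy invariant.\<close>

definition bd_winding :: "(real \<Rightarrow> complex \<times> complex \<times> complex) \<Rightarrow> complex" where
  "bd_winding p = winding_number (\<lambda>t. snd (snd (p t))) 0"

lemma third_component_path:
  assumes "path p" "path_image p \<subseteq> tetrablock_bd"
  shows "path (\<lambda>t. snd (snd (p t)))" "0 \<notin> path_image (\<lambda>t. snd (snd (p t)))"
proof -
  show "path (\<lambda>t. snd (snd (p t)))"
    using assms(1) unfolding path_def by (intro continuous_on_snd)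
  have "norm (snd (snd (p t))) = 1" if "t \<in> {0..1}" for t
    using that assms(2) by (force simp: path_image_def tetrablock_bd_def)
  thus "0 \<notin> path_image (\<lambda>t. snd (snd (p t)))"
    unfolding path_image_def by (metis (no_types, lifting) imageE norm_zero zero_neq_one)
qed

lemma third_component_nonzero_on_bd:
  "continuous_on tetrablock_bd (\<lambda>y. snd (snd y))" "(\<lambda>y. snd (snd y)) \<in> tetrablock_bd \<rightarrow> -{0}"
  by (auto intro!: continuous_intros simp: tetrablock_bd_def)

text \<open>A homotopy of the third components in the punctured plane lifts to the distinguished boundary:
  it is normalised to have modulus 1, the second components are joined by segments in the disc, and
  the first component is determined by the other two. The last two conclusions
  serve to show that the lift fixes common endpoints of \<open>p\<close> and \<open>q\<close> if \<open>h\<close> does, and that it consists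
  of closed paths if \<open>h\<close> does.\<close>

lemma square_homotopy_in_bd:
  fixes h :: "real \<times> real \<Rightarrow> complex"
  assumes p: "path p" "path_image p \<subseteq> tetrablock_bd"
    and q: "path q" "path_image q \<subseteq> tetrablock_bd"
    and h: "continuous_on ({0..1} \<times> {0..1}) h" "h \<in> {0..1} \<times> {0..1} \<rightarrow> -{0}"
      "\<forall>t\<in>{0..1}. h (0, t) = snd (snd (p t))" "\<forall>t\<in>{0..1}. h (1, t) = snd (snd (q t))"
  obtains H where "continuous_on ({0..1} \<times> {0..1}) H" "H \<in> {0..1} \<times> {0..1} \<rightarrow> tetrablock_bd"
    "\<forall>t\<in>{0..1}. H (0, t) = p t" "\<forall>t\<in>{0..1}. H (1, t) = q t"
    "\<forall>s. \<forall>t\<in>{0..1}. p t = q t \<longrightarrow> h (s, t) = snd (snd (p t)) \<longrightarrow> H (s, t) = p t"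
    "\<forall>s t t'. p t = p t' \<longrightarrow> q t = q t' \<longrightarrow> h (s, t) = h (s, t') \<longrightarrow> H (s, t) = H (s, t')"
proof -
  define v where
    "v z = of_real (1 - fst z) * fst (snd (p (snd z))) + of_real (fst z) * fst (snd (q (snd z)))" for z
  define u where "u z = h z / of_real (norm (h z))" for z
  define H where "H z = (cnj (v z) * u z, v z, u z)" for z
  have pT: "p t \<in> tetrablock_bd" and qT: "q t \<in> tetrablock_bd" if "t \<in> {0..1}" for t
    using that p(2) q(2) by (auto simp: path_image_def)
  have hnz: "h z \<noteq> 0" if "z \<in> {0..1} \<times> {0..1}" for z using h(2) that by blast
  have contp: "continuous_on ({0..1} \<times> {0..1}) (\<lambda>z::real \<times> real. p (snd z))"
    and contq: "continuous_on ({0..1} \<times> {0..1}) (\<lambda>z::real \<times> real. q (snd z))"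
    using p(1) q(1) unfolding path_def
    by (auto intro!: continuous_on_compose2[of "{0..1}"] continuous_intros)
  have "continuous_on ({0..1} \<times> {0..1}) H"
    unfolding H_def v_def u_def
    by (intro continuous_intros h(1) contp contq) (use hnz in auto)
  moreover have "H \<in> {0..1} \<times> {0..1} \<rightarrow> tetrablock_bd"
  proof
    fix z :: "real \<times> real" assume z: "z \<in> {0..1} \<times> {0..1}"
    have n: "norm (fst (snd (p (snd z)))) \<le> 1" "norm (fst (snd (q (snd z)))) \<le> 1"
      using pT[of "snd z"] qT[of "snd z"] z by (auto simp: tetrablock_bd_def)
    have "norm (v z) \<le> (1 - fst z) * norm (fst (snd (p (snd z)))) + fst z * norm (fst (snd (q (snd z))))"
      unfolding v_def using z by (intro norm_triangle_le) (auto simp: norm_mult simp del: of_real_diff)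
    also have "\<dots> \<le> (1 - fst z) * 1 + fst z * 1"
      using n z by (intro add_mono mult_left_mono) auto
    finally have "norm (v z) \<le> 1" by simp
    thus "H z \<in> tetrablock_bd"
      using hnz[OF z] by (simp add: H_def u_def tetrablock_bd_def norm_divide)
  qed
  moreover have fixed: "H (s, t) = y"
    if "y \<in> tetrablock_bd" "h (s, t) = snd (snd y)" "v (s, t) = fst (snd y)" for s t y
    using that by (auto simp: H_def u_def tetrablock_bd_def)
  have "\<forall>t\<in>{0..1}. H (0, t) = p t" "\<forall>t\<in>{0..1}. H (1, t) = q t"
    using h(3,4) pT qT by (auto intro!: fixed simp: v_def)
  moreover have "H (s, t) = p t" if "t \<in> {0..1}" "p t = q t" "h (s, t) = snd (snd (p t))" for s t
  proof (rule fixed[OF pT[OF that(1)] that(3)])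
    show "v (s, t) = fst (snd (p t))" using that(2) by (simp add: v_def algebra_simps)
  qed
  moreover have "H (s, t) = H (s, t')" if "p t = p t'" "q t = q t'" "h (s, t) = h (s, t')" for s t t'
    using that by (simp add: H_def u_def v_def)
  ultimately show ?thesis by (intro that[of H]) blast+
qed

lemma homotopic_paths_bd_iff:
  assumes p: "path p" "path_image p \<subseteq> tetrablock_bd"
    and q: "path q" "path_image q \<subseteq> tetrablock_bd"
    and ends: "pathstart q = pathstart p" "pathfinish q = pathfinish p"
  shows "homotopic_paths tetrablock_bd p q \<longleftrightarrow> bd_winding p = bd_winding q"
proof
  assume "homotopic_paths tetrablock_bd p q"
  hence "homotopic_paths (-{0}) ((\<lambda>y. snd (snd y)) \<circ> p) ((\<lambda>y. snd (snd y)) \<circ> q)"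
    by (rule homotopic_paths_continuous_image[OF _ third_component_nonzero_on_bd])
  thus "bd_winding p = bd_winding q"
    unfolding bd_winding_def using winding_number_homotopic_paths by (auto simp: o_def)
next
  assume "bd_winding p = bd_winding q"
  hence "homotopic_paths (-{0}) (\<lambda>t. snd (snd (p t))) (\<lambda>t. snd (snd (q t)))"
    unfolding bd_winding_def using third_component_path[OF p] third_component_path[OF q] ends
    by (subst (asm) winding_number_homotopic_paths_eq) (auto simp: pathstart_def pathfinish_def)
  then obtain h :: "real \<times> real \<Rightarrow> complex" where h: "continuous_on ({0..1} \<times> {0..1}) h" "h \<in> {0..1} \<times> {0..1} \<rightarrow> -{0}"
      "\<forall>t\<in>{0..1}. h (0, t) = snd (snd (p t))" "\<forall>t\<in>{0..1}. h (1, t) = snd (snd (q t))"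
    and h_ends: "\<forall>s\<in>{0..1}. h (s, 0) = snd (snd (p 0)) \<and> h (s, 1) = snd (snd (p 1))"
    unfolding homotopic_paths by (auto simp: pathstart_def pathfinish_def)
  obtain H where H: "continuous_on ({0..1} \<times> {0..1}) H" "H \<in> {0..1} \<times> {0..1} \<rightarrow> tetrablock_bd"
    "\<forall>t\<in>{0..1}. H (0, t) = p t" "\<forall>t\<in>{0..1}. H (1, t) = q t"
    "\<forall>s. \<forall>t\<in>{0..1}. p t = q t \<longrightarrow> h (s, t) = snd (snd (p t)) \<longrightarrow> H (s, t) = p t"
    "\<forall>s t t'. p t = p t' \<longrightarrow> q t = q t' \<longrightarrow> h (s, t) = h (s, t') \<longrightarrow> H (s, t) = H (s, t')"
    using square_homotopy_in_bd[OF p q h] .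
  show "homotopic_paths tetrablock_bd p q"
    unfolding homotopic_paths
  proof (intro exI[of _ H] conjI H(1-4) ballI)
    fix s :: real assume s: "s \<in> {0..1}"
    have "H (s, 0) = p 0" using H(5) h_ends s ends(1) by (simp add: pathstart_def)
    thus "pathstart (H \<circ> Pair s) = pathstart p" by (simp add: pathstart_def)
    have "H (s, 1) = p 1" using H(5) h_ends s ends(2) by (simp add: pathfinish_def)
    thus "pathfinish (H \<circ> Pair s) = pathfinish p" by (simp add: pathfinish_def)
  qed
qed

lemma homotopic_loops_bd_iff:
  assumes p: "path p" "path_image p \<subseteq> tetrablock_bd"
    and q: "path q" "path_image q \<subseteq> tetrablock_bd"
    and loops: "pathfinish p = pathstart p" "pathfinish q = pathstart q"
  shows "homotopic_loops tetrablock_bd p q \<longleftrightarrow> bd_winding p = bd_winding q"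
proof
  assume "homotopic_loops tetrablock_bd p q"
  hence "homotopic_loops (-{0}) ((\<lambda>y. snd (snd y)) \<circ> p) ((\<lambda>y. snd (snd y)) \<circ> q)"
    by (rule homotopic_loops_continuous_image[OF _ third_component_nonzero_on_bd])
  thus "bd_winding p = bd_winding q"
    unfolding bd_winding_def using winding_number_homotopic_loops by (auto simp: o_def)
next
  assume "bd_winding p = bd_winding q"
  hence "homotopic_loops (-{0}) (\<lambda>t. snd (snd (p t))) (\<lambda>t. snd (snd (q t)))"
    unfolding bd_winding_def using third_component_path[OF p] third_component_path[OF q] loops
    by (subst (asm) winding_number_homotopic_loops_eq) (auto simp: pathstart_def pathfinish_def)
  then obtain h :: "real \<times> real \<Rightarrow> complex" where h: "continuous_on ({0..1} \<times> {0..1}) h" "h \<in> {0..1} \<times> {0..1} \<rightarrow> -{0}"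
      "\<forall>t\<in>{0..1}. h (0, t) = snd (snd (p t))" "\<forall>t\<in>{0..1}. h (1, t) = snd (snd (q t))"
    and h_ends: "\<forall>s\<in>{0..1}. h (s, 1) = h (s, 0)"
    unfolding homotopic_loops by (auto simp: pathstart_def pathfinish_def)
  obtain H where H: "continuous_on ({0..1} \<times> {0..1}) H" "H \<in> {0..1} \<times> {0..1} \<rightarrow> tetrablock_bd"
    "\<forall>t\<in>{0..1}. H (0, t) = p t" "\<forall>t\<in>{0..1}. H (1, t) = q t"
    "\<forall>s. \<forall>t\<in>{0..1}. p t = q t \<longrightarrow> h (s, t) = snd (snd (p t)) \<longrightarrow> H (s, t) = p t"
    "\<forall>s t t'. p t = p t' \<longrightarrow> q t = q t' \<longrightarrow> h (s, t) = h (s, t') \<longrightarrow> H (s, t) = H (s, t')"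
    using square_homotopy_in_bd[OF p q h] .
  show "homotopic_loops tetrablock_bd p q"
    unfolding homotopic_loops
  proof (intro exI[of _ H] conjI H(1-4) ballI)
    fix s :: real assume s: "s \<in> {0..1}"
    have "p 1 = p 0" "q 1 = q 0" "h (s, 1) = h (s, 0)"
      using loops h_ends s by (simp_all add: pathstart_def pathfinish_def)
    hence "H (s, 1) = H (s, 0)" using H(6) by blast
    thus "pathfinish (H \<circ> Pair s) = pathstart (H \<circ> Pair s)"
      by (simp add: pathstart_def pathfinish_def)
  qed
qed

lemma bd_winding_join:
  assumes "path p" "path_image p \<subseteq> tetrablock_bd" "path q" "path_image q \<subseteq> tetrablock_bd"
    and "pathfinish p = pathstart q"
  shows "bd_winding (p +++ q) = bd_winding p + bd_winding q"
proof -
  have "(\<lambda>t. snd (snd ((p +++ q) t))) = (\<lambda>t. snd (snd (p t))) +++ (\<lambda>t. snd (snd (q t)))"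
    by (auto simp: joinpaths_def)
  thus ?thesis
    unfolding bd_winding_def
    using third_component_path[OF assms(1,2)] third_component_path[OF assms(3,4)] assms(5)
    by (simp add: winding_number_join pathstart_def pathfinish_def)
qed

lemma bd_winding_integer:
  assumes "p \<in> loops_at tetrablock_bd b"
  shows "\<exists>k::int. bd_winding p = of_int k"
proof -
  have "bd_winding p \<in> \<int>"
    unfolding bd_winding_def using assms
    by (intro integer_winding_number third_component_path)
       (auto simp: loops_at_def pathstart_def pathfinish_def)
  thus ?thesis by (auto elim: Ints_cases)
qed

text \<open>The loop keeps the second coordinate of \<open>b\<close> and turns the third one \<open>k\<close> times around the circle.\<close>

lemma exists_bd_loop:
  assumes "b \<in> tetrablock_bd"
  obtains p where "p \<in> loops_at tetrablock_bd b" "bd_winding p = of_int k"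
proof -
  obtain b1 b2 b3 where b: "b = (b1, b2, b3)" by (cases b) auto
  have nb: "norm b3 = 1" "norm b2 \<le> 1" "b1 = cnj b2 * b3"
    using assms by (auto simp: b tetrablock_bd_def)
  define g where "g t = Ln b3 + 2 * of_real pi * \<i> * of_int k * of_real t" for t :: real
  define p where "p t = (cnj b2 * exp (g t), b2, exp (g t))" for t
  have "b3 \<noteq> 0" using nb(1) by auto
  hence eLn: "exp (Ln b3) = b3" by simp
  have e: "exp (g t) = b3 * exp (2 * of_real pi * \<i> * of_int k * of_real t)" for t
    by (simp add: g_def exp_add eLn)
  have "exp (2 * of_real pi * \<i> * of_int k) = (1::complex)"
    using exp_integer_2pi[of "of_int k"] by (simp add: mult_ac)
  hence ends: "exp (g 0) = b3" "exp (g 1) = b3" by (simp_all add: e)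
  have "norm (exp (2 * of_real pi * \<i> * of_int k * of_real t)) = 1" for t by simp
  hence norm1: "norm (exp (g t)) = 1" for t
    unfolding e norm_mult nb(1) by simp
  have contg: "path g" unfolding path_def g_def by (intro continuous_intros)
  have "path p" using contg unfolding path_def p_def by (intro continuous_intros)
  moreover have "p t \<in> tetrablock_bd" for t
    using norm1 nb by (simp add: p_def tetrablock_bd_def)
  ultimately have "p \<in> loops_at tetrablock_bd b"
    using ends nb(3) by (auto simp: loops_at_def pathstart_def pathfinish_def b p_def path_image_def)
  moreover have "bd_winding p = of_int k"
  proof -
    have "bd_winding p = winding_number (exp \<circ> g) 0"
      by (simp add: bd_winding_def p_def o_def)
    also have "\<dots> = of_int k"
      using winding_number_compose_exp[OF contg]
      by (simp add: g_def pathstart_def pathfinish_def)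
    finally show ?thesis .
  qed
  ultimately show ?thesis by (rule that)
qed

lemma bd_winding_standard_loop:
  "bd_winding (\<lambda>t. (0, 0, circle_loop t)) = 1"
proof -
  define g where "g t = 2 * of_real pi * \<i> * of_real t" for t :: real
  have "bd_winding (\<lambda>t. (0, 0, circle_loop t)) = winding_number (exp \<circ> g) 0"
    by (simp add: bd_winding_def circle_loop_def o_def g_def cis_conv_exp mult_ac)
  moreover have "path g" unfolding path_def g_def by (intro continuous_intros)
  ultimately show ?thesis
    by (simp add: winding_number_compose_exp g_def pathstart_def pathfinish_def)
qed

section \<open>The fundamental group of the distinguished boundary\<close>

definition class_winding :: "(real \<Rightarrow> complex \<times> complex \<times> complex) set \<Rightarrow> int" where
  "class_winding A = (THE k. \<exists>p\<in>A. bd_winding p = of_int k)"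

lemma class_winding_path_class:
  assumes p: "p \<in> loops_at tetrablock_bd b" and k: "bd_winding p = of_int k"
  shows "class_winding (path_class tetrablock_bd p) = k"
  unfolding class_winding_def
proof (rule the_equality)
  have "p \<in> path_class tetrablock_bd p" using p by (simp add: path_class_def loops_at_def)
  thus "\<exists>q\<in>path_class tetrablock_bd p. bd_winding q = of_int k" using k by blast
next
  fix l assume "\<exists>q\<in>path_class tetrablock_bd p. bd_winding q = of_int l"
  then obtain q where q: "homotopic_paths tetrablock_bd p q" "bd_winding q = of_int l"
    by (auto simp: path_class_def)
  have "bd_winding p = bd_winding q"
    using q(1) homotopic_paths_bd_iff homotopic_paths_imp_path homotopic_paths_imp_subset
      homotopic_paths_imp_pathstart homotopic_paths_imp_pathfinish by metis
  thus "l = k" using k q by simp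
qed

lemma path_class_eq:
  assumes "homotopic_paths S p q"
  shows "path_class S p = path_class S q"
  using assms unfolding path_class_def
  by (auto intro: homotopic_paths_trans homotopic_paths_sym)

text \<open>The winding number is therefore well defined and injective on the fundamental group.\<close>

lemma path_class_bd_eq_iff:
  assumes p: "p \<in> loops_at tetrablock_bd b" and q: "q \<in> loops_at tetrablock_bd b"
  shows "path_class tetrablock_bd p = path_class tetrablock_bd q \<longleftrightarrow> bd_winding p = bd_winding q"
proof -
  have "homotopic_paths tetrablock_bd p q \<longleftrightarrow> bd_winding p = bd_winding q"
    using p q by (intro homotopic_paths_bd_iff) (auto simp: loops_at_def)
  moreover have "q \<in> path_class tetrablock_bd q" using q by (simp add: path_class_def loops_at_def)
  ultimately show ?thesis using path_class_eq by (auto simp: path_class_def)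
qed

lemma loops_at_join:
  "p \<in> loops_at S b \<Longrightarrow> q \<in> loops_at S b \<Longrightarrow> p +++ q \<in> loops_at S b"
  by (auto simp: loops_at_def path_image_join)

text \<open>Concatenation respects homotopy, so the union that defines the product is one of equal sets.\<close>

lemma fundamental_group_mult:
  assumes "p \<in> loops_at S b" "q \<in> loops_at S b"
  shows "path_class S p \<otimes>\<^bsub>fundamental_group S b\<^esub> path_class S q = path_class S (p +++ q)"
proof -
  have eq: "path_class S (p' +++ q') = path_class S (p +++ q)"
    if "p' \<in> path_class S p" "q' \<in> path_class S q" for p' q'
    using that assms
    by (intro path_class_eq homotopic_paths_sym[OF homotopic_paths_join])
       (auto simp: path_class_def loops_at_def)
  have "p \<in> path_class S p" "q \<in> path_class S q"
    using assms by (auto simp: path_class_def loops_at_def)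
  hence ne: "path_class S p \<noteq> {}" "path_class S q \<noteq> {}" by blast+
  have "path_class S p \<otimes>\<^bsub>fundamental_group S b\<^esub> path_class S q
      = (\<Union>p'\<in>path_class S p. \<Union>q'\<in>path_class S q. path_class S (p' +++ q'))"
    by (simp add: fundamental_group_def)
  also have "\<dots> = (\<Union>p'\<in>path_class S p. \<Union>q'\<in>path_class S q. path_class S (p +++ q))"
    by (intro SUP_cong refl eq)
  also have "\<dots> = path_class S (p +++ q)" using ne by simp
  finally show ?thesis .
qed

lemma fundamental_group_mult_closed:
  assumes "A \<in> carrier (fundamental_group S b)" "B \<in> carrier (fundamental_group S b)"
  shows "A \<otimes>\<^bsub>fundamental_group S b\<^esub> B \<in> carrier (fundamental_group S b)"
proof -
  obtain p q where pq: "p \<in> loops_at S b" "A = path_class S p" "q \<in> loops_at S b" "B = path_class S q"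
    using assms by (auto simp: fundamental_group_def)
  have "path_class S (p +++ q) \<in> carrier (fundamental_group S b)"
    using loops_at_join[OF pq(1,3)] by (simp add: fundamental_group_def)
  thus ?thesis by (simp add: pq fundamental_group_mult)
qed

lemma class_winding_iso:
  assumes b: "b \<in> tetrablock_bd"
  shows "class_winding \<in> iso (fundamental_group tetrablock_bd b) integer_group"
proof (rule isoI)
  let ?G = "fundamental_group tetrablock_bd b"
  have carrier: "carrier ?G = path_class tetrablock_bd ` loops_at tetrablock_bd b"
    by (simp add: fundamental_group_def)
  have obt: thesis if "A \<in> carrier ?G"
    and "\<And>p k. \<lbrakk>p \<in> loops_at tetrablock_bd b; A = path_class tetrablock_bd p;
           bd_winding p = of_int k; class_winding A = k\<rbrakk> \<Longrightarrow> thesis" for A thesis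
    using that bd_winding_integer class_winding_path_class unfolding carrier by blast
  show "class_winding \<in> hom ?G integer_group"
  proof (rule homI)
    fix A B assume A: "A \<in> carrier ?G" and B: "B \<in> carrier ?G"
    obtain p k where p: "p \<in> loops_at tetrablock_bd b" "A = path_class tetrablock_bd p"
        "bd_winding p = of_int k" "class_winding A = k"
      using obt[OF A] .
    obtain q l where q: "q \<in> loops_at tetrablock_bd b" "B = path_class tetrablock_bd q"
        "bd_winding q = of_int l" "class_winding B = l"
      using obt[OF B] .
    have "bd_winding (p +++ q) = of_int (k + l)"
      using p q by (simp add: loops_at_def bd_winding_join)
    hence "class_winding (path_class tetrablock_bd (p +++ q)) = k + l"
      using class_winding_path_class loops_at_join p(1) q(1) by blast
    thus "class_winding (A \<otimes>\<^bsub>?G\<^esub> B) = class_winding A \<otimes>\<^bsub>integer_group\<^esub> class_winding B"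
      using p q by (simp add: fundamental_group_mult)
  qed simp
  show "bij_betw class_winding (carrier ?G) (carrier integer_group)"
  proof (rule bij_betwI')
    fix A B assume A: "A \<in> carrier ?G" and B: "B \<in> carrier ?G"
    obtain p k where p: "p \<in> loops_at tetrablock_bd b" "A = path_class tetrablock_bd p"
        "bd_winding p = of_int k" "class_winding A = k"
      using obt[OF A] .
    obtain q l where q: "q \<in> loops_at tetrablock_bd b" "B = path_class tetrablock_bd q"
        "bd_winding q = of_int l" "class_winding B = l"
      using obt[OF B] .
    show "class_winding A = class_winding B \<longleftrightarrow> A = B"
      using path_class_bd_eq_iff[OF p(1) q(1)] p q by auto
  next
    fix k :: int
    obtain p where "p \<in> loops_at tetrablock_bd b" "bd_winding p = of_int k"
      using exists_bd_loop[OF b] .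
    thus "\<exists>A\<in>carrier ?G. k = class_winding A"
      unfolding carrier using class_winding_path_class by blast
  qed simp
qed

text \<open>The winding number is invariant under free homotopy, hence is 1 on every loop freely homotopic to
  the standard one.\<close>

lemma class_winding_identification:
  assumes b: "b \<in> tetrablock_bd"
  shows "tetra_pi1_identification b class_winding"
  unfolding tetra_pi1_identification_def
proof (intro conjI ballI impI class_winding_iso[OF b])
  fix p assume p: "p \<in> loops_at tetrablock_bd b"
    "homotopic_loops tetrablock_bd p (\<lambda>t. (0, 0, circle_loop t))"
  have "bd_winding p = bd_winding (\<lambda>t. (0, 0, circle_loop t))"
    using p(2) homotopic_loops_bd_iff homotopic_loops_imp_path homotopic_loops_imp_subset
      homotopic_loops_imp_loop by metis
  thus "class_winding (path_class tetrablock_bd p) = 1"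
    using class_winding_path_class[OF p(1), of 1] by (simp add: bd_winding_standard_loop)
qed

text \<open>Transported by the winding number isomorphism, an identification becomes an additive map from the
  integers to themselves. The free homotopy condition applies to the loop of winding number 1 at
  \<open>b\<close>, so this map sends 1 to 1 and is the identity. (Without that loop the sign would remain
  undetermined.)\<close>

lemma tetra_pi1_identification_unique:
  assumes b: "b \<in> tetrablock_bd" and \<phi>: "tetra_pi1_identification b \<phi>"
    and A: "A \<in> carrier (fundamental_group tetrablock_bd b)"
  shows "\<phi> A = class_winding A"
proof -
  let ?G = "fundamental_group tetrablock_bd b"
  have hom_w: "class_winding \<in> hom ?G integer_group"
    and bij: "bij_betw class_winding (carrier ?G) UNIV"
    using class_winding_iso[OF b] unfolding iso_def carrier_integer_group by blast+
  have hom_phi: "\<phi> \<in> hom ?G integer_group"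
    using \<phi> unfolding tetra_pi1_identification_def iso_def by blast
  define g where "g = inv_into (carrier ?G) class_winding"
  have g: "g k \<in> carrier ?G" "class_winding (g k) = k" for k
    unfolding g_def
    by (rule bij_betwE[OF bij_betw_inv_into[OF bij], rule_format, OF UNIV_I])
       (rule bij_betw_inv_into_right[OF bij UNIV_I])
  have inj: "B = C" if "B \<in> carrier ?G" "C \<in> carrier ?G" "class_winding B = class_winding C" for B C
    using inj_onD[OF bij_betw_imp_inj_on[OF bij] that(3,1,2)] .
  have add: "\<phi> (g (k + l)) = \<phi> (g k) + \<phi> (g l)" for k l
  proof -
    \<comment> \<open>elements of the fundamental group are equal if their winding numbers are\<close>
    have "g (k + l) = g k \<otimes>\<^bsub>?G\<^esub> g l"
      using hom_mult[OF hom_w g(1) g(1), of k l] by (intro inj fundamental_group_mult_closed g(1)) (simp add: g(2))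
    thus ?thesis using hom_mult[OF hom_phi g(1) g(1), of k l] by simp
  qed
  have one: "\<phi> (g 1) = 1"
  proof -
    obtain p where p: "p \<in> loops_at tetrablock_bd b" "bd_winding p = of_int 1"
      using exists_bd_loop[OF b] .
    have "homotopic_loops tetrablock_bd p (\<lambda>t. (0, 0, circle_loop t)) \<longleftrightarrow>
            bd_winding p = bd_winding (\<lambda>t. (0, 0, circle_loop t))"
    proof (rule homotopic_loops_bd_iff)
      show "path (\<lambda>t. (0::complex, 0::complex, circle_loop t))"
        unfolding path_def circle_loop_def by (intro continuous_intros)
    qed (use p(1) in \<open>auto simp: loops_at_def path_image_def tetrablock_bd_def circle_loop_def
           pathstart_def pathfinish_def\<close>)
    hence "homotopic_loops tetrablock_bd p (\<lambda>t. (0, 0, circle_loop t))"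
      using p(2) bd_winding_standard_loop by simp
    hence "\<phi> (path_class tetrablock_bd p) = 1"
      using \<phi> p(1) unfolding tetra_pi1_identification_def by blast
    moreover have "g 1 = path_class tetrablock_bd p"
    proof (intro inj g(1))
      show "path_class tetrablock_bd p \<in> carrier ?G"
        using p(1) by (simp add: fundamental_group_def)
    qed (simp add: g(2) class_winding_path_class[OF p])
    ultimately show ?thesis by simp
  qed
  have "\<phi> (g k) = k" for k :: int
  proof (induction k rule: int_induct[where k = 0])
    case base
    show ?case using add[of 0 0] by simp
  next
    case (step1 i)
    thus ?case using add[of i 1] one by simp
  next
    case (step2 i)
    thus ?case using add[of "i - 1" 1] one by simp
  qed
  moreover have "g (class_winding A) = A" using inj[OF g(1) A] g(2) by simp
  ultimately show ?thesis by metis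
qed

lemma induced_map_path_class:
  assumes "continuous_on S f" "f \<in> S \<rightarrow> T" "path p" "path_image p \<subseteq> S"
  shows "induced_map T f (path_class S p) = path_class T (f \<circ> p)"
proof -
  have "path_class T (f \<circ> q) = path_class T (f \<circ> p)" if "q \<in> path_class S p" for q
  proof (rule path_class_eq[OF homotopic_paths_continuous_image[OF _ assms(1,2)]])
    show "homotopic_paths S q p"
      using that unfolding path_class_def by (auto intro: homotopic_paths_sym)
  qed
  hence "induced_map T f (path_class S p) = (\<Union>q\<in>path_class S p. path_class T (f \<circ> p))"
    unfolding induced_map_def by (intro SUP_cong refl)
  moreover have "path_class S p \<noteq> {}"
    using assms(3,4) homotopic_paths_refl[of S p] unfolding path_class_def by blast
  ultimately show ?thesis by simp
qed

lemma circle_loop_in_loops_at: "circle_loop \<in> loops_at (sphere 0 1) 1"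
proof -
  have "path circle_loop" unfolding path_def circle_loop_def by (intro continuous_intros)
  thus ?thesis by (auto simp: loops_at_def path_image_def circle_loop_def pathstart_def pathfinish_def)
qed

lemma tetra_degree_eq_winding:
  assumes cont: "continuous_on (sphere 0 1) x" and im: "x ` sphere 0 1 \<subseteq> tetrablock_bd"
    and n: "bd_winding (x \<circ> circle_loop) = of_nat n"
  shows "tetra_degree x = n"
proof -
  let ?c = "path_class tetrablock_bd (x \<circ> circle_loop)"
  have circle: "path circle_loop" "path_image circle_loop \<subseteq> sphere 0 1"
      "pathstart circle_loop = 1" "pathfinish circle_loop = 1"
    using circle_loop_in_loops_at by (auto simp: loops_at_def)
  have b: "x 1 \<in> tetrablock_bd" using im by auto
  have "path (x \<circ> circle_loop)"
    by (intro path_continuous_image circle(1) continuous_on_subset[OF cont circle(2)])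
  moreover have "path_image (x \<circ> circle_loop) \<subseteq> tetrablock_bd"
    using circle(2) im unfolding path_image_compose by blast
  ultimately have loop: "x \<circ> circle_loop \<in> loops_at tetrablock_bd (x 1)"
    using circle(3,4) by (simp add: loops_at_def pathstart_compose pathfinish_compose)
  have ind: "induced_map tetrablock_bd x (path_class (sphere 0 1) circle_loop) = ?c"
    using im by (intro induced_map_path_class cont circle) blast
  have "class_winding ?c = int n"
    using class_winding_path_class[OF loop, of "int n"] n by simp
  moreover have "?c \<in> carrier (fundamental_group tetrablock_bd (x 1))"
    using loop by (simp add: fundamental_group_def)
  ultimately have phi: "\<phi> ?c = int n" if "tetra_pi1_identification (x 1) \<phi>" for \<phi>
    using tetra_pi1_identification_unique[OF b that] by simp
  show ?thesis
    unfolding tetra_degree_def ind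
  proof (rule the_equality)
    show "\<exists>\<phi>. tetra_pi1_identification (x 1) \<phi> \<and> \<phi> ?c = int n"
      using phi class_winding_identification[OF b] by blast
  next
    fix m assume "\<exists>\<phi>. tetra_pi1_identification (x 1) \<phi> \<and> \<phi> ?c = int m"
    thus "m = n" using phi by fastforce
  qed
qed

section \<open>The degree of an inner function\<close>

text \<open>For \<open>0 \<le> s \<le> 1\<close> replace \<open>D z\<close> by \<open>D (s z)\<close>. Since \<open>D\<close> has no zeros in the closed disc this is a
  homotopy of loops in the punctured plane, and at \<open>s = 0\<close> it is a constant times \<open>z\<^sup>n\<close>.\<close>

lemma winding_number_reflected_quotient:
  assumes deg: "degree D \<le> n" and D: "\<And>z. z \<in> cball 0 1 \<Longrightarrow> poly D z \<noteq> 0"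
  shows "winding_number (\<lambda>t. circle_loop t ^ n * cnj (poly D (circle_loop t)) / poly D (circle_loop t)) 0 = of_nat n"
proof -
  define c where "c = cnj (poly D 0) / poly D 0"
  have "c \<noteq> 0" using D[of 0] by (simp add: c_def)
  define g where "g t = of_nat n * (2 * of_real pi * \<i> * of_real t) + Ln c" for t :: real
  define h where "h z = circle_loop (snd z) ^ n * cnj (poly D (of_real (fst z) * circle_loop (snd z))) /
      poly D (of_real (fst z) * circle_loop (snd z))" for z
  have norm_circle: "norm (circle_loop t) = 1" for t by (simp add: circle_loop_def)
  have nz: "poly D (of_real (fst z) * circle_loop (snd z)) \<noteq> 0" if "z \<in> {0..1} \<times> {0..1}" for z
    using that by (intro D) (auto simp: norm_mult norm_circle)
  have "homotopic_loops (-{0}) (exp \<circ> g)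
      (\<lambda>t. circle_loop t ^ n * cnj (poly D (circle_loop t)) / poly D (circle_loop t))"
    unfolding homotopic_loops
  proof (intro exI[of _ h] conjI ballI)
    show "continuous_on ({0..1} \<times> {0..1}) h"
      unfolding h_def using nz by (auto simp: circle_loop_def intro!: continuous_intros)
    have "circle_loop t \<noteq> 0" for t using norm_circle[of t] by auto
    thus "h \<in> {0..1} \<times> {0..1} \<rightarrow> -{0}"
      using nz unfolding h_def by auto
    show "h (0, t) = (exp \<circ> g) t" for t
    proof -
      have "exp (g t) = exp (2 * of_real pi * \<i> * of_real t) ^ n * c"
        using \<open>c \<noteq> 0\<close> by (simp add: g_def exp_add exp_of_nat_mult)
      thus ?thesis by (simp add: h_def c_def circle_loop_def cis_conv_exp mult_ac)
    qed
    show "h (1, t) = circle_loop t ^ n * cnj (poly D (circle_loop t)) / poly D (circle_loop t)" for t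
      by (simp add: h_def)
    show "pathfinish (h \<circ> Pair s) = pathstart (h \<circ> Pair s)" for s
      by (simp add: h_def pathfinish_def pathstart_def circle_loop_def)
  qed
  hence "winding_number (\<lambda>t. circle_loop t ^ n * cnj (poly D (circle_loop t)) / poly D (circle_loop t)) 0
      = winding_number (exp \<circ> g) 0"
    using winding_number_homotopic_loops by metis
  moreover have "path g" unfolding path_def g_def by (intro continuous_intros)
  ultimately show ?thesis
    by (simp add: winding_number_compose_exp g_def pathstart_def pathfinish_def)
qed

lemma tetra_degree_eq_representation_degree:
  assumes x: "rational_tetra_inner x" and rep: "representation_of_degree n x E1 E2 D"
  shows "tetra_degree x = n"
proof (rule tetra_degree_eq_winding)
  have D: "\<And>z. z \<in> cball 0 1 \<Longrightarrow> poly D z \<noteq> 0" and deg: "degree D \<le> n"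
    and x3: "\<And>z. z \<in> cball 0 1 \<Longrightarrow> snd (snd (x z)) = poly (conj_reflect n D) z / poly D z"
    using rep unfolding representation_of_degree_def by auto
  show "continuous_on (sphere 0 1) x"
    using x unfolding rational_tetra_inner_def by (auto intro: continuous_on_subset)
  show "x ` sphere 0 1 \<subseteq> tetrablock_bd"
    using x unfolding rational_tetra_inner_def by blast
  have "snd (snd (x (circle_loop t))) =
      circle_loop t ^ n * cnj (poly D (circle_loop t)) / poly D (circle_loop t)" for t
    using x3[of "circle_loop t"] poly_conj_reflect_on_circle[OF deg, of "circle_loop t"]
    by (simp add: circle_loop_def)
  thus "bd_winding (x \<circ> circle_loop) = of_nat n"
    using winding_number_reflected_quotient[OF deg D] by (simp add: bd_winding_def)
qed

section \<open>The royal polynomial\<close>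

text \<open>The boundary relations make \<open>E\<^sub>1\<close> and \<open>E\<^sub>2\<close> each other's reflections. So reflection with respect to
  degree \<open>2n\<close> exchanges the factors in each of the two products.\<close>

lemma royal_polynomial_self_inversive:
  assumes x: "rational_tetra_inner x" and rep: "representation_of_degree n x E1 E2 D"
  defines "R \<equiv> conj_reflect n D * D - E1 * E2"
  shows "conj_reflect (2 * n) R = R"
proof -
  have deg: "degree E1 \<le> n" "degree E2 \<le> n" "degree D \<le> n"
    and x_eq: "\<And>z. z \<in> cball 0 1 \<Longrightarrow> poly D z \<noteq> 0 \<and>
        x z = (poly E1 z / poly D z, poly E2 z / poly D z, poly (conj_reflect n D) z / poly D z)"
    using rep unfolding representation_of_degree_def by auto
  have refl: "conj_reflect n E1 = E2"
  proof (rule poly_eq_on_circle)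
    fix z :: complex assume z: "z \<in> sphere 0 1"
    have "poly D z \<noteq> 0" "poly E2 z / poly D z =
        cnj (poly E1 z / poly D z) * (poly (conj_reflect n D) z / poly D z)"
      using x_eq[of z] inner_on_circle(2)[OF x z] z by auto
    thus "poly (conj_reflect n E1) z = poly E2 z"
      using z by (simp add: poly_conj_reflect_on_circle deg field_simps)
  qed
  have "conj_reflect (2 * n) R = conj_reflect (n + n) (conj_reflect n D * D) - conj_reflect (n + n) (E1 * E2)"
    by (rule poly_eqI) (auto simp: coeff_conj_reflect R_def mult_2)
  also have "\<dots> = conj_reflect n (conj_reflect n D) * conj_reflect n D - conj_reflect n E1 * conj_reflect n E2"
    using deg by (simp add: conj_reflect_mult degree_conj_reflect_le)
  also have "conj_reflect n E2 = E1"
    using refl conj_reflect_conj_reflect[OF deg(1)] by simp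
  finally show ?thesis
    using deg refl by (simp add: conj_reflect_conj_reflect R_def mult.commute)
qed

lemma royal_variety_iff_royal_polynomial:
  assumes rep: "representation_of_degree n x E1 E2 D" and z: "z \<in> cball 0 1"
  shows "x z \<in> royal_variety \<longleftrightarrow> poly (conj_reflect n D * D - E1 * E2) z = 0"
proof -
  have "poly D z \<noteq> 0"
    "x z = (poly E1 z / poly D z, poly E2 z / poly D z, poly (conj_reflect n D) z / poly D z)"
    using rep z unfolding representation_of_degree_def by auto
  thus ?thesis by (auto simp: royal_variety_def field_simps)
qed

text \<open>The royal polynomial is formed from an arbitrarily chosen representation; all that matters is
  that one exists with the topological degree as its formal degree.\<close>

lemma royal_polynomial_eq:
  assumes x: "rational_tetra_inner x"
  obtains E1 E2 D where "representation_of_degree (tetra_degree x) x E1 E2 D"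
    "royal_polynomial x = conj_reflect (tetra_degree x) D * D - E1 * E2"
proof -
  let ?P = "\<lambda>(E1, E2, D). tetra_representation x E1 E2 D"
  have same: "tetra_representation x E1 E2 D \<longleftrightarrow> representation_of_degree (tetra_degree x) x E1 E2 D"
    for E1 E2 D by (simp add: tetra_representation_def representation_of_degree_def Let_def)
  obtain n F1 F2 G where rep: "representation_of_degree n x F1 F2 G"
    using exists_representation_of_degree[OF x] .
  hence "?P (F1, F2, G)"
    using tetra_degree_eq_representation_degree[OF x rep] same by simp
  hence some: "?P (SOME t. ?P t)" by (rule someI)
  obtain E1 E2 D where t: "(SOME t. ?P t) = (E1, E2, D)" by (metis prod_cases3)
  show ?thesis
  proof (rule that)
    have "tetra_representation x E1 E2 D" using some unfolding t by simp
    thus "representation_of_degree (tetra_degree x) x E1 E2 D" by (simp only: same)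
    show "royal_polynomial x = conj_reflect (tetra_degree x) D * D - E1 * E2"
      by (simp add: royal_polynomial_def t)
  qed
qed

lemma inner_image_in_closure:
  assumes "rational_tetra_inner x"
  shows "x ` cball 0 1 \<subseteq> closure tetrablock"
proof -
  have "continuous_on (closure (ball 0 1)) x" "x ` ball 0 1 \<subseteq> closure tetrablock"
    using assms unfolding rational_tetra_inner_def by auto
  from image_closure_subset[OF this(1) closed_closure this(2)] show ?thesis by simp
qed

theorem theorem1p1:
  fixes x :: "complex \<Rightarrow> complex \<times> complex \<times> complex"
  assumes "rational_tetra_inner x"
    and "\<not> x constant_on ball 0 1"
  shows "x ` cball 0 1 \<subseteq> royal_variety \<inter> closure tetrablock \<or>
         finite (royal_nodes x) \<and>
         (\<Sum>\<sigma>\<in>royal_nodes x. royal_multiplicity x \<sigma>) = real (tetra_degree x)"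
proof -
  define n where "n = tetra_degree x"
  define R where "R = royal_polynomial x"
  obtain E1 E2 D where rep: "representation_of_degree n x E1 E2 D"
      and R_eq: "R = conj_reflect n D * D - E1 * E2"
    using royal_polynomial_eq[OF assms(1)] unfolding n_def R_def .
  have node_iff: "x z \<in> royal_variety \<longleftrightarrow> poly R z = 0" if "z \<in> cball 0 1" for z
    using royal_variety_iff_royal_polynomial[OF rep that] by (simp add: R_eq)
  show ?thesis
  proof (cases "R = 0")
    case True
    hence "x ` cball 0 1 \<subseteq> royal_variety" using node_iff by auto
    thus ?thesis using inner_image_in_closure[OF assms(1)] by blast
  next
    case False
    have nodes: "royal_nodes x = {a. a \<in> cball 0 1 \<and> poly R a = 0}"
      using node_iff by (auto simp: royal_nodes_def)
    have "finite (royal_nodes x)"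
      unfolding nodes using poly_roots_finite[OF False] by (rule rev_finite_subset) auto
    moreover have "(\<Sum>\<sigma>\<in>royal_nodes x. royal_multiplicity x \<sigma>) = real n"
      using self_inversive_root_count[OF royal_polynomial_self_inversive[OF assms(1) rep]] False
      unfolding nodes royal_multiplicity_def R_def[symmetric] R_eq[symmetric] by simp
    ultimately show ?thesis by (simp add: n_def)
  qed
qed

end
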